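(* Let $f:\mathbb{R}^m\rightarrow\mathbb{R}$ be a $C^1$ function, let $\delta_0>0$ and $0<\alpha,\beta<1$, let $z_0\in\mathbb{R}^m$ be arbitrary, and let $\{z_n\}_{n\ge 0}$ be the Backtracking gradient descent sequence defined by $$z_n=z_{n-1}-\delta(f,\delta_0,z_{n-1})\nabla f(z_{n-1}),\qquad n=1,2,3,\ldots$$ Then: 1) Either $\lim_{n\to\infty}\|z_n\|=\infty$ or $\lim_{n\to\infty}\|z_{n+1}-z_n\|=0$. 2) Assume that $f$ has at most countably many critical points. Then either $\lim_{n\to\infty}\|z_n\|=\infty$ or $\{z_n\}$ converges to a critical point of $f$. 3) More generally, assume that all connected components of the set of critical points of $f$ are compact. Then either $\lim_{n\to\infty}\|z_n\|=\infty$ or $\{z_n\}$ is bounded. Moreover, in the latter case the set of cluster points of $\{z_n\}$ is connected.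
   Context: $\|\cdot\|$ is the Euclidean norm on $\mathbb{R}^m$. A critical point of $f$ is a point where $\nabla f$ vanishes. Given a $C^1$ function $f$, $\delta_0>0$ and $0<\alpha,\beta<1$, for $x\in\mathbb{R}^m$ the number $\delta(f,\delta_0,x)$ is the largest $\sigma$ in $\{\beta^n\delta_0: n=0,1,2,\ldots\}$ for which $$f(x-\sigma\nabla f(x))-f(x)\le-\alpha\sigma\|\nabla f(x)\|^2.$$ (Such a $\sigma$ always exists, so $\delta(f,\delta_0,x)$ is well-defined and positive.) A cluster point of a sequence is a limit of one of its convergent subsequences (in $\mathbb{R}^m$). *)

theory Defs
  imports "HOL-Analysis.Analysis"
begin

text \<open>Meaningful only where \<open>f\<close> is differentiable; see \<open>gradient_eqI\<close> and \<open>GDERIV_gradient\<close>.\<close>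

definition gradient :: "('a::real_inner \<Rightarrow> real) \<Rightarrow> 'a \<Rightarrow> 'a" where
  "gradient f x = (THE D. GDERIV f x :> D)"

definition C1_function :: "('a::real_inner \<Rightarrow> real) \<Rightarrow> bool" where
  "C1_function f \<longleftrightarrow> (\<forall>x. f differentiable (at x)) \<and> continuous_on UNIV (gradient f)"

definition critical_points :: "('a::real_inner \<Rightarrow> real) \<Rightarrow> 'a set" where
  "critical_points f = {x. gradient f x = 0}"

text \<open>Where \<open>f\<close> is differentiable the greatest element exists; see \<open>backtracking_step_wf\<close>.\<close>

definition backtracking_step ::
    "real \<Rightarrow> real \<Rightarrow> ('a::real_inner \<Rightarrow> real) \<Rightarrow> real \<Rightarrow> 'a \<Rightarrow> real" where
  "backtracking_step \<alpha> \<beta> f \<delta>\<^sub>0 x =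
     (GREATEST \<sigma>. \<sigma> \<in> {\<beta> ^ n * \<delta>\<^sub>0 |n::nat. True} \<and>
        f (x - \<sigma> *\<^sub>R gradient f x) - f x \<le> - \<alpha> * \<sigma> * (norm (gradient f x))\<^sup>2)"

definition cluster_points :: "(nat \<Rightarrow> 'a::topological_space) \<Rightarrow> 'a set" where
  "cluster_points z = {l. \<exists>r. strict_mono r \<and> (z \<circ> r) \<longlonglongrightarrow> l}"

lemma gradient_eqI:
  assumes "GDERIV f x :> D"
  shows "gradient f x = D"
  unfolding gradient_def
proof (rule the_equality[where P = "\<lambda>D. GDERIV f x :> D", OF assms])
  fix E assume "GDERIV f x :> E"
  with assms have "(\<lambda>h. inner h E) = (\<lambda>h. inner h D)"
    unfolding gderiv_def by (rule has_derivative_unique[rotated])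
  then have "inner (E - D) E = inner (E - D) D" by metis
  then show "E = D" by (metis inner_eq_zero_iff inner_diff_right right_minus_eq)
qed

lemma GDERIV_gradient:
  fixes f :: "'a::euclidean_space \<Rightarrow> real"
  assumes "f differentiable (at x)"
  shows "GDERIV f x :> gradient f x"
proof -
  from assms obtain f' where f': "(f has_derivative f') (at x)"
    unfolding differentiable_def by blast
  then interpret linear f' by (rule has_derivative_linear)
  define D where "D = (\<Sum>b\<in>Basis. f' b *\<^sub>R b)"
  have "f' h = inner h D" for h
  proof -
    have "f' h = f' (\<Sum>b\<in>Basis. inner h b *\<^sub>R b)" by (simp add: euclidean_representation)
    also have "\<dots> = inner h D"
      by (simp add: D_def sum scale inner_sum_right mult.commute)
    finally show ?thesis .
  qed
  then have "f' = (\<lambda>h. inner h D)" by blast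
  with f' have "GDERIV f x :> D" by (simp add: gderiv_def)
  then show ?thesis using gradient_eqI by metis
qed

lemma backtracking_step_wf:
  fixes f :: "'a::euclidean_space \<Rightarrow> real"
  assumes diff: "f differentiable (at x)"
    and "\<delta>\<^sub>0 > 0" "0 < \<alpha>" "\<alpha> < 1" "0 < \<beta>" "\<beta> < 1"
  defines "P \<equiv> \<lambda>\<sigma>. \<sigma> \<in> {\<beta> ^ n * \<delta>\<^sub>0 |n::nat. True} \<and>
        f (x - \<sigma> *\<^sub>R gradient f x) - f x \<le> - \<alpha> * \<sigma> * (norm (gradient f x))\<^sup>2"
  shows "P (backtracking_step \<alpha> \<beta> f \<delta>\<^sub>0 x)"
    and "P \<sigma> \<Longrightarrow> \<sigma> \<le> backtracking_step \<alpha> \<beta> f \<delta>\<^sub>0 x"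
proof -
  let ?g = "gradient f x"
  have "\<exists>n. P (\<beta> ^ n * \<delta>\<^sub>0)"
  proof (cases "?g = 0")
    case True
    then show ?thesis by (auto simp: P_def)
  next
    case False
    have "(f has_derivative (\<lambda>h. inner h ?g)) (at x)"
      using GDERIV_gradient[OF diff] by (simp add: gderiv_def)
    moreover have "(1 - \<alpha>) * norm ?g > 0" using assms(4) False by simp
    ultimately obtain d where d: "d > 0"
      and *: "\<And>y. norm (y - x) < d \<Longrightarrow>
        norm (f y - f x - inner (y - x) ?g) \<le> (1 - \<alpha>) * norm ?g * norm (y - x)"
      unfolding has_derivative_at_alt by blast
    have "(\<lambda>n. \<beta> ^ n * \<delta>\<^sub>0 * norm ?g) \<longlonglongrightarrow> 0 * \<delta>\<^sub>0 * norm ?g"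
      using assms by (intro tendsto_intros LIMSEQ_realpow_zero) auto
    then have "(\<lambda>n. \<beta> ^ n * \<delta>\<^sub>0 * norm ?g) \<longlonglongrightarrow> 0" by simp
    from order_tendstoD(2)[OF this d] obtain n where n: "\<beta> ^ n * \<delta>\<^sub>0 * norm ?g < d"
      by (auto simp: eventually_sequentially)
    define s where "s = \<beta> ^ n * \<delta>\<^sub>0"
    have s: "s > 0" using assms by (simp add: s_def)
    have "norm ((x - s *\<^sub>R ?g) - x) < d" using n s by (simp add: s_def)
    from *[OF this] s have
      "\<bar>f (x - s *\<^sub>R ?g) - f x + s * (norm ?g)\<^sup>2\<bar> \<le> (1 - \<alpha>) * norm ?g * (s * norm ?g)"
      by (simp add: power2_norm_eq_inner)
    also have "\<dots> = s * (norm ?g)\<^sup>2 - \<alpha> * s * (norm ?g)\<^sup>2"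
      by (simp add: power2_eq_square algebra_simps)
    finally have "f (x - s *\<^sub>R ?g) - f x \<le> - \<alpha> * s * (norm ?g)\<^sup>2" by linarith
    then show ?thesis unfolding P_def s_def by blast
  qed
  define N where "N = (LEAST n. P (\<beta> ^ n * \<delta>\<^sub>0))"
  have N: "P (\<beta> ^ N * \<delta>\<^sub>0)" unfolding N_def using \<open>\<exists>n. _\<close> by (rule LeastI_ex)
  have le: "\<sigma> \<le> \<beta> ^ N * \<delta>\<^sub>0" if "P \<sigma>" for \<sigma>
  proof -
    obtain k where k: "\<sigma> = \<beta> ^ k * \<delta>\<^sub>0" using \<open>P \<sigma>\<close> by (auto simp: P_def)
    with \<open>P \<sigma>\<close> have "N \<le> k" by (auto simp: N_def intro: Least_le)
    then show ?thesis using assms k by (simp add: power_decreasing)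
  qed
  have "backtracking_step \<alpha> \<beta> f \<delta>\<^sub>0 x = (GREATEST \<sigma>. P \<sigma>)"
    by (simp add: backtracking_step_def P_def)
  also have "\<dots> = \<beta> ^ N * \<delta>\<^sub>0" by (rule Greatest_equality) (use N le in auto)
  finally have eq: "backtracking_step \<alpha> \<beta> f \<delta>\<^sub>0 x = \<beta> ^ N * \<delta>\<^sub>0" .
  show "P (backtracking_step \<alpha> \<beta> f \<delta>\<^sub>0 x)" using N eq by simp
  show "P \<sigma> \<Longrightarrow> \<sigma> \<le> backtracking_step \<alpha> \<beta> f \<delta>\<^sub>0 x" using le eq by simp
qed

end

(* The function values decrease along the sequence, so they converge as soon as there is one cluster
   point; the Armijo condition then forces the steps to 0, and since the step sizes are bounded away
   from 0 near a noncritical point, every cluster point is critical. A sequence with vanishing steps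
   cannot keep leaving and re-entering a small neighbourhood of a compact set A that is clopen in its
   set of cluster points without clustering in between, so it converges to A. When the components of
   the critical set are compact, such a set A is supplied by the Sura-Bura theorem.  The countable
   case reduces to this one, as countable connected sets have at most one point. *)
theory Submission
  imports Defs
begin

section \<open>Cluster points of sequences with vanishing steps\<close>

text \<open>Tail closures replace subsequences: closedness becomes immediate, and membership is
  tested by arbitrarily late close terms. Conversely, dependent choice of later and later terms
  within \<open>1 / (k + 1)\<close> of \<open>l\<close> builds the subsequence.\<close>

lemma cluster_points_eq_Inter_closure:
  fixes z :: "nat \<Rightarrow> 'a::metric_space"
  shows "cluster_points z = (\<Inter>n. closure (z ` {n..}))"
proof (intro equalityI subsetI INT_I)
  fix l n assume "l \<in> cluster_points z"
  then obtain r where r: "strict_mono r" "(z \<circ> r) \<longlonglongrightarrow> l"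
    unfolding cluster_points_def by blast
  have "(z \<circ> r) k \<in> closure (z ` {n..})" if "k \<ge> n" for k
    using that seq_suble[OF r(1), of k] closure_subset by fastforce
  then have "\<forall>\<^sub>F k in sequentially. (z \<circ> r) k \<in> closure (z ` {n..})"
    unfolding eventually_sequentially by blast
  with r(2) show "l \<in> closure (z ` {n..})"
    by (intro Lim_in_closed_set[OF closed_closure]) auto
next
  fix l assume l: "l \<in> (\<Inter>n. closure (z ` {n..}))"
  have close: "\<exists>m\<ge>n. dist (z m) l < e" if "e > 0" for n e
  proof -
    have "l \<in> closure (z ` {n..})" using l by blast
    then show ?thesis using that unfolding closure_approachable by auto
  qed
  have "\<exists>r. \<forall>k. dist (z (r k)) l < inverse (real (Suc k)) \<and> r k < r (Suc k)"
  proof (rule dependent_nat_choice)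
    show "\<exists>m. dist (z m) l < inverse (real (Suc 0))"
      using close[of 1 0] by auto
  next
    fix m k
    have "\<exists>j\<ge>Suc m. dist (z j) l < inverse (real (Suc (Suc k)))"
      by (rule close) simp
    then show "\<exists>j. dist (z j) l < inverse (real (Suc (Suc k))) \<and> m < j"
      by (meson Suc_le_lessD)
  qed
  then obtain r where r: "\<And>k. dist (z (r k)) l < inverse (real (Suc k))" "\<And>k. r k < r (Suc k)"
    by blast
  have "(\<lambda>k. dist ((z \<circ> r) k) l) \<longlonglongrightarrow> 0"
    by (rule tendsto_sandwich[OF _ _ tendsto_const LIMSEQ_inverse_real_of_nat])
      (use r(1) in \<open>auto intro!: always_eventually less_imp_le simp del: of_nat_Suc\<close>)
  then have "(z \<circ> r) \<longlonglongrightarrow> l" using tendsto_dist_iff by blast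
  moreover have "strict_mono r" using r(2) by (simp add: strict_mono_Suc_iff)
  ultimately show "l \<in> cluster_points z" unfolding cluster_points_def by blast
qed

lemma closed_cluster_points:
  fixes z :: "nat \<Rightarrow> 'a::metric_space"
  shows "closed (cluster_points z)"
  by (simp add: cluster_points_eq_Inter_closure closed_INT)

lemma frequently_near_cluster_point:
  fixes z :: "nat \<Rightarrow> 'a::metric_space"
  assumes "l \<in> cluster_points z" "e > 0"
  shows "\<exists>\<^sub>F n in sequentially. dist (z n) l < e"
  unfolding frequently_sequentially
proof
  fix n
  have "l \<in> closure (z ` {n..})" using assms(1) by (auto simp: cluster_points_eq_Inter_closure)
  then show "\<exists>m\<ge>n. dist (z m) l < e" using assms(2) unfolding closure_approachable by auto
qed

lemma cluster_point_in_compact: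
  fixes z :: "nat \<Rightarrow> 'a::metric_space"
  assumes "compact K" and freq: "\<exists>\<^sub>F n in sequentially. z n \<in> K"
  obtains x where "x \<in> K" "x \<in> cluster_points z"
proof -
  from freq have "\<forall>k. \<exists>n\<ge>k. z n \<in> K" by (simp add: frequently_sequentially)
  \<comment> \<open>\<open>s\<close> need not be increasing, so \<open>z \<circ> s\<close> need not
    be a subsequence of \<open>z\<close>; \<open>s k \<ge> k\<close> still places its late values in
    every tail, which suffices for the closure description.\<close>
  then obtain s where s: "\<And>k. s k \<ge> k" "\<And>k. z (s k) \<in> K" by metis
  obtain x r where x: "x \<in> K" "strict_mono (r :: nat \<Rightarrow> nat)" "((z \<circ> s) \<circ> r) \<longlonglongrightarrow> x"
    using \<open>compact K\<close> s(2) unfolding compact_def by (metis comp_apply)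
  have "x \<in> closure (z ` {n..})" for n
  proof (rule Lim_in_closed_set[OF closed_closure _ _ x(3)])
    have "((z \<circ> s) \<circ> r) k \<in> closure (z ` {n..})" if "k \<ge> n" for k
    proof -
      have "s (r k) \<ge> n" using that s(1)[of "r k"] seq_suble[OF x(2), of k] by linarith
      then show ?thesis using closure_subset by fastforce
    qed
    then show "\<forall>\<^sub>F k in sequentially. ((z \<circ> s) \<circ> r) k \<in> closure (z ` {n..})"
      unfolding eventually_sequentially by blast
  qed simp
  then show ?thesis using that x(1) by (auto simp: cluster_points_eq_Inter_closure)
qed

text \<open>A sequence that does not escape to infinity returns infinitely often to some closed
  ball, which is compact.\<close>

lemma cluster_points_nonempty:
  fixes z :: "nat \<Rightarrow> 'a::{real_normed_vector,heine_borel}"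
  assumes "\<not> filterlim (\<lambda>n. norm (z n)) at_top sequentially"
  shows "cluster_points z \<noteq> {}"
proof -
  obtain M where M: "\<not> (\<forall>\<^sub>F n in sequentially. M \<le> norm (z n))"
    using assms unfolding filterlim_at_top by blast
  have "\<exists>\<^sub>F n in sequentially. z n \<in> cball 0 M"
    using M unfolding not_eventually by (rule frequently_elim1) simp
  then show ?thesis using cluster_point_in_compact[OF compact_cball] by blast
qed

text \<open>For small \<open>r\<close> the compact shell \<open>r \<le> infdist x A \<le> 2 * r\<close> contains no cluster point, and steps
  shorter than \<open>r\<close> cannot jump over it.\<close>

lemma infdist_tendsto_zero_if_clopen:
  fixes z :: "nat \<Rightarrow> 'a::heine_borel"
  assumes steps: "(\<lambda>n. dist (z (Suc n)) (z n)) \<longlonglongrightarrow> 0"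
    and A: "compact A" "A \<noteq> {}" "A \<subseteq> cluster_points z"
    and B: "closed (cluster_points z - A)"
  shows "(\<lambda>n. infdist (z n) A) \<longlonglongrightarrow> 0"
proof -
  obtain d where d: "d > 0" "\<And>x y. x \<in> A \<Longrightarrow> y \<in> cluster_points z - A \<Longrightarrow> d \<le> dist x y"
    using separate_compact_closed[OF A(1) B] by blast
  \<comment> \<open>Distances from cluster points to \<open>A\<close> omit the open interval from 0
    to \<open>d\<close>; the shell \<open>K\<close> is placed in that gap.\<close>
  have gap: "infdist x A = 0 \<or> d \<le> infdist x A" if "x \<in> cluster_points z" for x
  proof (cases "x \<in> A")
    case False
    then have "d \<le> infdist x A"
      using that d(2) A(2) by (auto simp: infdist_notempty dist_commute intro!: cINF_greatest)
    then show ?thesis ..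
  qed simp
  have near: "\<forall>\<^sub>F n in sequentially. infdist (z n) A < r" if r: "0 < r" "2 * r < d" for r
  proof -
    define K where "K = {x. infdist x A \<le> 2 * r} \<inter> {x. r \<le> infdist x A}"
    have "closed {x. r \<le> infdist x A}"
      by (intro closed_Collect_le continuous_intros)
    then have "compact K"
      unfolding K_def using compact_infdist_le[OF A(2,1), of "2 * r"] r by (intro compact_Int_closed) auto
    have "K \<inter> cluster_points z = {}" using gap r by (force simp: K_def)
    then have "\<not> (\<exists>\<^sub>F n in sequentially. z n \<in> K)"
      using cluster_point_in_compact[OF \<open>compact K\<close>, of z] by blast
    then have "\<forall>\<^sub>F n in sequentially. z n \<notin> K" by (simp add: not_frequently)
    moreover have "\<forall>\<^sub>F n in sequentially. dist (z (Suc n)) (z n) < r"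
      using order_tendstoD(2)[OF steps] r by blast
    ultimately have "\<forall>\<^sub>F n in sequentially. z n \<notin> K \<and> dist (z (Suc n)) (z n) < r"
      by (rule eventually_conj)
    then obtain N where N: "\<And>n. n \<ge> N \<Longrightarrow> z n \<notin> K" "\<And>n. n \<ge> N \<Longrightarrow> dist (z (Suc n)) (z n) < r"
      unfolding eventually_sequentially by blast
    obtain a where a: "a \<in> A" using A(2) by blast
    \<comment> \<open>Points of \<open>A\<close> are cluster points, so some term past
      \<open>N\<close> comes within \<open>r\<close> of \<open>A\<close>; the induction shows that
      no later term gets out.\<close>
    then obtain n where n: "n \<ge> N" "dist (z n) a < r"
      using frequently_near_cluster_point[of a z r] A(3) r by (auto simp: frequently_sequentially)
    have "infdist (z m) A < r" if "m \<ge> n" for m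
      using that
    proof (induction m rule: dec_induct)
      case base
      then show ?case using infdist_le[OF a, of "z n"] n by linarith
    next
      case (step m)
      have "infdist (z (Suc m)) A \<le> infdist (z m) A + dist (z (Suc m)) (z m)"
        by (rule infdist_triangle)
      also have "\<dots> < 2 * r" using step N(2)[of m] n by simp
      \<comment> \<open>Below \<open>2 * r\<close> but outside the shell \<open>K\<close>, the
        distance can only be below \<open>r\<close>.\<close>
      finally show ?case using N(1)[of "Suc m"] step n by (simp add: K_def)
    qed
    then show ?thesis unfolding eventually_sequentially by blast
  qed
  show ?thesis
  proof (rule order_tendstoI)
    fix e :: real assume "e > 0"
    \<comment> \<open>The bound \<open>d / 3\<close> secures \<open>2 * r < d\<close>.\<close>
    have "\<forall>\<^sub>F n in sequentially. infdist (z n) A < min e (d / 3)"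
      using \<open>e > 0\<close> d(1) by (intro near) auto
    then show "\<forall>\<^sub>F n in sequentially. infdist (z n) A < e" by eventually_elim simp
  next
    fix e :: real assume "e < 0"
    then show "\<forall>\<^sub>F n in sequentially. e < infdist (z n) A"
      by (intro always_eventually allI) (meson infdist_nonneg less_le_trans)
  qed
qed

text \<open>All but finitely many terms lie in the closed 1-neighbourhood of \<open>A\<close>, which
  is compact.\<close>

lemma bounded_range_if_infdist_tendsto_zero:
  fixes z :: "nat \<Rightarrow> 'a::heine_borel"
  assumes "compact A" "A \<noteq> {}" "(\<lambda>n. infdist (z n) A) \<longlonglongrightarrow> 0"
  shows "bounded (range z)"
proof -
  obtain N where N: "\<And>n. n \<ge> N \<Longrightarrow> infdist (z n) A < 1"
    using order_tendstoD(2)[OF assms(3), of 1] by (auto simp: eventually_sequentially)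
  have "range z \<subseteq> z ` {..<N} \<union> {x. infdist x A \<le> 1}"
  proof (rule image_subsetI)
    fix n show "z n \<in> z ` {..<N} \<union> {x. infdist x A \<le> 1}"
      using N[of n] by (cases "n < N") auto
  qed
  moreover have "bounded {x. infdist x A \<le> 1}"
    using compact_infdist_le[OF assms(2,1), of 1] by (simp add: compact_imp_bounded)
  ultimately show ?thesis
    by (meson bounded_Un bounded_subset finite_imageI finite_imp_bounded finite_lessThan)
qed

text \<open>\<open>infdist\<close> is continuous, so it vanishes at every subsequential limit; for
  closed \<open>A\<close> this means membership.\<close>

lemma cluster_points_subset_if_infdist_tendsto_zero:
  fixes z :: "nat \<Rightarrow> 'a::metric_space"
  assumes "closed A" "A \<noteq> {}" "(\<lambda>n. infdist (z n) A) \<longlonglongrightarrow> 0"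
  shows "cluster_points z \<subseteq> A"
proof
  fix x assume "x \<in> cluster_points z"
  then obtain r where r: "strict_mono r" "(z \<circ> r) \<longlonglongrightarrow> x"
    unfolding cluster_points_def by blast
  have "(\<lambda>k. infdist ((z \<circ> r) k) A) \<longlonglongrightarrow> infdist x A"
    by (rule tendsto_infdist[OF r(2)])
  moreover have "(\<lambda>k. infdist ((z \<circ> r) k) A) \<longlonglongrightarrow> 0"
    using LIMSEQ_subseq_LIMSEQ[OF assms(3) r(1)] by (simp add: o_def)
  ultimately have "infdist x A = 0" by (rule LIMSEQ_unique)
  then show "x \<in> A" using assms(1,2) by (simp add: in_closed_iff_infdist_zero)
qed

text \<open>If the set split into two disjoint nonempty closed pieces, one of them would be compact
  with closed complement, so the distance of \<open>z n\<close> to it would tend to 0, leaving no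
  cluster point for the other.\<close>

lemma connected_cluster_points:
  fixes z :: "nat \<Rightarrow> 'a::heine_borel"
  assumes steps: "(\<lambda>n. dist (z (Suc n)) (z n)) \<longlonglongrightarrow> 0" and bdd: "bounded (range z)"
  shows "connected (cluster_points z)"
proof -
  let ?D = "cluster_points z"
  have "?D \<subseteq> closure (z ` {0..})"
    unfolding cluster_points_eq_Inter_closure by (rule INT_lower) simp
  then have "compact ?D"
    using bdd closed_cluster_points
    by (metis atLeast_0 bounded_closure bounded_subset compact_eq_bounded_closed)
  have False
    if AB: "closed A" "closed B" "A \<noteq> {}" "B \<noteq> {}" "A \<union> B = ?D" "A \<inter> B = {}" for A B
  proof -
    have "compact A" using AB \<open>compact ?D\<close> by (metis Un_upper1 closed_subset compact_Int_closed inf.absorb_iff2)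
    moreover have "?D - A = B" using AB by blast
    ultimately have "(\<lambda>n. infdist (z n) A) \<longlonglongrightarrow> 0"
      using infdist_tendsto_zero_if_clopen[OF steps, of A] AB by blast
    then have "?D \<subseteq> A" using cluster_points_subset_if_infdist_tendsto_zero AB by blast
    then show False using AB by blast
  qed
  then show ?thesis
    unfolding connected_closed_set[OF closed_cluster_points] by metis
qed

text \<open>One compact component suffices: in the locally compact set of cluster points, Sura-Bura
  encloses it in a compact relatively open set \<open>A\<close>, which attracts the whole
  sequence.\<close>

lemma bounded_if_component_compact:
  fixes z :: "nat \<Rightarrow> 'a::euclidean_space"
  assumes steps: "(\<lambda>n. dist (z (Suc n)) (z n)) \<longlonglongrightarrow> 0"
    and C: "C \<in> components (cluster_points z)" "compact C"
  shows "bounded (range z)"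
proof -
  have "locally compact (cluster_points z)"
    by (rule closed_imp_locally_compact[OF closed_cluster_points])
  then obtain A where A: "openin (top_of_set (cluster_points z)) A" "compact A" "C \<subseteq> A"
    by (rule Sura_Bura_clopen_subset[OF _ C open_UNIV subset_UNIV])
  have "A \<noteq> {}" using in_components_nonempty[OF C(1)] A(3) by blast
  moreover have "A \<subseteq> cluster_points z" using A(1) openin_imp_subset by blast
  moreover have "closed (cluster_points z - A)"
  proof -
    obtain T where "open T" "A = cluster_points z \<inter> T" using A(1) by (auto simp: openin_open)
    then show ?thesis using closed_Diff[OF closed_cluster_points] by (simp add: Diff_Int)
  qed
  ultimately show ?thesis
    using infdist_tendsto_zero_if_clopen[OF steps A(2)] bounded_range_if_infdist_tendsto_zero[OF A(2)]
    by blast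
qed

text \<open>A lone cluster point forms a compact set with empty complement, and
  \<open>infdist\<close> to a singleton is the distance.\<close>

lemma tendsto_if_unique_cluster_point:
  fixes z :: "nat \<Rightarrow> 'a::heine_borel"
  assumes "(\<lambda>n. dist (z (Suc n)) (z n)) \<longlonglongrightarrow> 0" and "cluster_points z = {l}"
  shows "z \<longlonglongrightarrow> l"
  using infdist_tendsto_zero_if_clopen[OF assms(1), of "{l}"] assms(2)
  by (simp add: tendsto_dist_iff[of z])

section \<open>The backtracking iteration\<close>

text \<open>By continuity of the gradient, one and the same trial step satisfies the Armijo
  condition at all points near a noncritical \<open>l\<close>.\<close>

lemma backtracking_step_eventually_ge:
  fixes f :: "'a::euclidean_space \<Rightarrow> real"
  assumes C1: "C1_function f"
    and par: "\<delta>\<^sub>0 > 0" "0 < \<alpha>" "\<alpha> < 1" "0 < \<beta>" "\<beta> < 1"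
    and l: "gradient f l \<noteq> 0"
  obtains s where "s > 0" "\<forall>\<^sub>F x in nhds l. s \<le> backtracking_step \<alpha> \<beta> f \<delta>\<^sub>0 x"
proof -
  let ?g = "gradient f"
  have diff: "f differentiable (at x)" for x using C1 by (simp add: C1_function_def)
  have g: "continuous_on UNIV ?g" using C1 by (simp add: C1_function_def)
  \<comment> \<open>\<open>h (x, t)\<close> is the rate of decrease of \<open>f\<close> at parameter
    \<open>t\<close> along the ray from \<open>x\<close> against the gradient, minus the rate that
    Armijo demands. At \<open>(l, 0)\<close> it equals
    \<open>(1 - \<alpha>) * (norm (?g l))\<^sup>2\<close>.\<close>
  define h where "h = (\<lambda>p. ?g (fst p - snd p *\<^sub>R ?g (fst p)) \<bullet> ?g (fst p) - \<alpha> * (norm (?g (fst p)))\<^sup>2)"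
  have "continuous_on UNIV h"
    unfolding h_def by (intro continuous_intros continuous_on_compose2[OF g]) auto
  then have "open {p. h p > 0}" by (intro open_Collect_less) auto
  moreover have "(l, 0) \<in> {p. h p > 0}"
    using l par by (simp add: h_def power2_norm_eq_inner)
  ultimately obtain U V where UV: "open U" "open V" "(l, 0) \<in> U \<times> V" "U \<times> V \<subseteq> {p. h p > 0}"
    by (rule open_prod_elim)
  obtain d where d: "d > 0" "ball 0 d \<subseteq> V" using UV(2,3) openE by blast
  \<comment> \<open>The trial step must have the form \<open>\<beta> ^ n * \<delta>\<^sub>0\<close>
    to be a candidate, and lie below \<open>d\<close> so that all smaller parameters stay in
    \<open>V\<close>.\<close>
  obtain n where n: "\<beta> ^ n < d / \<delta>\<^sub>0"
    using real_arch_pow_inv[of "d / \<delta>\<^sub>0" \<beta>] d par by auto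
  define s where "s = \<beta> ^ n * \<delta>\<^sub>0"
  have s: "s > 0" "s < d" using n par by (auto simp: s_def field_simps)
  have "s \<le> backtracking_step \<alpha> \<beta> f \<delta>\<^sub>0 x" if x: "x \<in> U" for x
  proof -
    have der: "((\<lambda>t. f (x - t *\<^sub>R ?g x)) has_real_derivative - (?g (x - t *\<^sub>R ?g x) \<bullet> ?g x)) (at t)" for t
    proof -
      have "(f has_derivative (\<lambda>v. v \<bullet> ?g (x - t *\<^sub>R ?g x))) (at (x - t *\<^sub>R ?g x))"
        using GDERIV_gradient[OF diff] by (simp add: gderiv_def)
      moreover have "((\<lambda>t. x - t *\<^sub>R ?g x) has_derivative (\<lambda>u. - (u *\<^sub>R ?g x))) (at t)"
        by (auto intro!: derivative_eq_intros)
      ultimately have "((\<lambda>t. f (x - t *\<^sub>R ?g x)) has_derivative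
          (\<lambda>u. - (u *\<^sub>R ?g x) \<bullet> ?g (x - t *\<^sub>R ?g x))) (at t)"
        by (rule has_derivative_compose[rotated])
      then show ?thesis
        unfolding has_field_derivative_def
        by (rule has_derivative_eq_rhs) (simp add: inner_commute fun_eq_iff)
    qed
    \<comment> \<open>The mean value theorem reduces the total decrease to the rate at a single
      \<open>t\<close> below \<open>s\<close>, where \<open>h (x, t)\<close> is positive.\<close>
    obtain t where t: "0 < t" "t < s"
      "f (x - s *\<^sub>R ?g x) - f (x - 0 *\<^sub>R ?g x) = (s - 0) * - (?g (x - t *\<^sub>R ?g x) \<bullet> ?g x)"
      using MVT2[OF s(1) der] by blast
    have "h (x, t) > 0" using UV(4) x d(2) t(1,2) s by (auto simp: dist_norm subset_iff)
    then have "s * (\<alpha> * (norm (?g x))\<^sup>2) \<le> s * (?g (x - t *\<^sub>R ?g x) \<bullet> ?g x)"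
      using s(1) by (simp add: h_def)
    then have "f (x - s *\<^sub>R ?g x) - f x \<le> - \<alpha> * s * (norm (?g x))\<^sup>2"
      using t(3) by (simp add: mult_ac)
    then show ?thesis
      by (intro backtracking_step_wf(2)[OF diff par]) (auto simp: s_def)
  qed
  then have "\<forall>\<^sub>F x in nhds l. s \<le> backtracking_step \<alpha> \<beta> f \<delta>\<^sub>0 x"
    using UV(1,3) unfolding eventually_nhds by blast
  with s(1) show ?thesis using that by blast
qed

section \<open>Vanishing steps and critical cluster points along a descent sequence\<close>

locale backtracking_descent =
  fixes f :: "'a::euclidean_space \<Rightarrow> real" and \<delta>\<^sub>0 \<alpha> \<beta> :: real and z :: "nat \<Rightarrow> 'a"
  assumes C1: "C1_function f"
    and par: "\<delta>\<^sub>0 > 0" "0 < \<alpha>" "\<alpha> < 1" "0 < \<beta>" "\<beta> < 1"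
    and rec: "\<And>n. z (Suc n) = z n - backtracking_step \<alpha> \<beta> f \<delta>\<^sub>0 (z n) *\<^sub>R gradient f (z n)"
begin

abbreviation "g \<equiv> gradient f"
abbreviation "\<delta> \<equiv> backtracking_step \<alpha> \<beta> f \<delta>\<^sub>0"

lemma diff: "f differentiable (at x)"
  using C1 by (simp add: C1_function_def)

lemma isCont_gradient: "isCont g x"
  using C1 by (simp add: C1_function_def continuous_on_eq_continuous_at)

lemma step_pos: "\<delta> x > 0" and step_le: "\<delta> x \<le> \<delta>\<^sub>0"
proof -
  obtain n where "\<delta> x = \<beta> ^ n * \<delta>\<^sub>0"
    using backtracking_step_wf(1)[OF diff par, of x] by blast
  then show "\<delta> x > 0" "\<delta> x \<le> \<delta>\<^sub>0"
    using par by (simp_all add: power_le_one)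
qed

lemma armijo: "\<alpha> * (\<delta> (z n) * (norm (g (z n)))\<^sup>2) \<le> f (z n) - f (z (Suc n))"
  using backtracking_step_wf(1)[OF diff par, of "z n"] by (simp add: rec)

text \<open>The values \<open>f (z n)\<close> decrease and are bounded below by \<open>f l\<close>,
  hence converge. Armijo bounds the quantity by consecutive differences divided by
  \<open>\<alpha>\<close>, and these tend to 0.\<close>

lemma decrease_tendsto_zero:
  assumes "l \<in> cluster_points z"
  shows "(\<lambda>n. \<delta> (z n) * (norm (g (z n)))\<^sup>2) \<longlonglongrightarrow> 0"
proof -
  obtain r where r: "strict_mono r" "(z \<circ> r) \<longlonglongrightarrow> l"
    using assms unfolding cluster_points_def by blast
  have "0 \<le> \<alpha> * (\<delta> (z n) * (norm (g (z n)))\<^sup>2)" for n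
    using par step_pos[of "z n"] by simp
  then have dec: "decseq (\<lambda>n. f (z n))"
    using armijo by (intro decseq_SucI) (meson diff_ge_0_iff_ge order_trans)
  have "(\<lambda>k. f ((z \<circ> r) k)) \<longlonglongrightarrow> f l"
    using r(2) differentiable_imp_continuous_within[OF diff] by (rule isCont_tendsto_compose[rotated])
  then have lim: "(\<lambda>k. f (z (r k))) \<longlonglongrightarrow> f l" by simp
  have "decseq (\<lambda>k. f (z (r k)))"
    using dec r(1) by (simp add: decseq_def strict_mono_less_eq)
  then have "f l \<le> f (z (r n))" for n using decseq_ge lim by blast
  \<comment> \<open>Since \<open>n \<le> r n\<close>, monotonicity carries the lower bound from the
    subsequence to every term.\<close>
  then have "f l \<le> f (z n)" for n
    using decseqD[OF dec seq_suble[OF r(1), of n]] by (meson order_trans)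
  then obtain L where L: "(\<lambda>n. f (z n)) \<longlonglongrightarrow> L" using decseq_convergent[OF dec] by blast
  have "(\<lambda>n. (f (z n) - f (z (Suc n))) / \<alpha>) \<longlonglongrightarrow> (L - L) / \<alpha>"
    using par by (intro tendsto_intros L LIMSEQ_Suc[OF L]) auto
  then have lim: "(\<lambda>n. (f (z n) - f (z (Suc n))) / \<alpha>) \<longlonglongrightarrow> 0" by simp
  have bound: "norm (\<delta> (z n) * (norm (g (z n)))\<^sup>2) \<le> (f (z n) - f (z (Suc n))) / \<alpha>" for n
    using armijo[of n] par step_pos[of "z n"] by (simp add: pos_le_divide_eq mult.commute abs_mult)
  show ?thesis by (rule Lim_null_comparison[OF always_eventually[OF allI[OF bound]] lim])
qed

text \<open>The squared step length is \<open>\<delta> (z n)\<close> times the quantity in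
  \<open>decrease_tendsto_zero\<close>, and \<open>\<delta>\<close> is at most
  \<open>\<delta>\<^sub>0\<close>.\<close>

lemma steps_tendsto_zero:
  assumes "cluster_points z \<noteq> {}"
  shows "(\<lambda>n. dist (z (Suc n)) (z n)) \<longlonglongrightarrow> 0"
proof -
  have bound: "(dist (z (Suc n)) (z n))\<^sup>2 \<le> \<delta>\<^sub>0 * (\<delta> (z n) * (norm (g (z n)))\<^sup>2)" for n
  proof -
    have "(dist (z (Suc n)) (z n))\<^sup>2 = \<delta> (z n) * (\<delta> (z n) * (norm (g (z n)))\<^sup>2)"
      by (simp add: rec dist_norm power_mult_distrib power2_eq_square)
    also have "\<dots> \<le> \<delta>\<^sub>0 * (\<delta> (z n) * (norm (g (z n)))\<^sup>2)"
      using step_le[of "z n"] step_pos[of "z n"] by (intro mult_right_mono) auto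
    finally show ?thesis .
  qed
  have "(\<lambda>n. \<delta>\<^sub>0 * (\<delta> (z n) * (norm (g (z n)))\<^sup>2)) \<longlonglongrightarrow> \<delta>\<^sub>0 * 0"
    using assms decrease_tendsto_zero by (intro tendsto_intros) blast
  then have "(\<lambda>n. \<delta>\<^sub>0 * (\<delta> (z n) * (norm (g (z n)))\<^sup>2)) \<longlonglongrightarrow> 0" by simp
  then have "(\<lambda>n. (dist (z (Suc n)) (z n))\<^sup>2) \<longlonglongrightarrow> 0"
    by (rule Lim_null_comparison[OF always_eventually, rotated]) (simp add: bound)
  then show ?thesis by simp
qed

text \<open>Near a noncritical \<open>l\<close> the step sizes stay above some \<open>s > 0\<close>,
  so \<open>decrease_tendsto_zero\<close> along the subsequence would give
  \<open>s * (norm (g l))\<^sup>2 \<le> 0\<close>.\<close>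

lemma cluster_points_subset_critical_points: "cluster_points z \<subseteq> critical_points f"
proof
  fix l assume l: "l \<in> cluster_points z"
  then obtain r where r: "strict_mono r" "(z \<circ> r) \<longlonglongrightarrow> l"
    unfolding cluster_points_def by blast
  have "g l = 0"
  proof (rule ccontr)
    assume "g l \<noteq> 0"
    from backtracking_step_eventually_ge[OF C1 par this]
    obtain s where s: "s > 0" "\<forall>\<^sub>F x in nhds l. s \<le> \<delta> x" by blast
    have "\<forall>\<^sub>F k in sequentially. s \<le> \<delta> ((z \<circ> r) k)"
      using s(2) r(2) by (rule eventually_compose_filterlim)
    then have le: "\<forall>\<^sub>F k in sequentially. s * (norm (g ((z \<circ> r) k)))\<^sup>2
        \<le> \<delta> ((z \<circ> r) k) * (norm (g ((z \<circ> r) k)))\<^sup>2"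
      by eventually_elim (simp add: mult_right_mono)
    have "(\<lambda>k. \<delta> ((z \<circ> r) k) * (norm (g ((z \<circ> r) k)))\<^sup>2) \<longlonglongrightarrow> 0"
      using LIMSEQ_subseq_LIMSEQ[OF decrease_tendsto_zero[OF l] r(1)] by (simp add: o_def)
    moreover have "(\<lambda>k. s * (norm (g ((z \<circ> r) k)))\<^sup>2) \<longlonglongrightarrow> s * (norm (g l))\<^sup>2"
      by (intro tendsto_intros isCont_tendsto_compose[OF isCont_gradient] r(2))
    ultimately have "s * (norm (g l))\<^sup>2 \<le> 0"
      using le by (rule tendsto_le[OF sequentially_bot])
    then show False using s(1) \<open>g l \<noteq> 0\<close> by (simp add: mult_le_0_iff)
  qed
  then show "l \<in> critical_points f" by (simp add: critical_points_def)
qed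

section \<open>Escape to infinity versus vanishing steps, boundedness and convergence\<close>

lemma steps_tendsto_zero_or_infinity:
  "filterlim (\<lambda>n. norm (z n)) at_top sequentially \<or> (\<lambda>n. dist (z (Suc n)) (z n)) \<longlonglongrightarrow> 0"
  using cluster_points_nonempty steps_tendsto_zero by blast

text \<open>A component of the set of cluster points is closed and lies inside a component of the
  critical set, so it inherits compactness.\<close>

lemma bounded_or_infinity:
  assumes comp: "\<And>C. C \<in> components (critical_points f) \<Longrightarrow> compact C"
  shows "filterlim (\<lambda>n. norm (z n)) at_top sequentially \<or> bounded (range z)"
proof (rule disj_imp[THEN iffD2], rule impI)
  assume "\<not> filterlim (\<lambda>n. norm (z n)) at_top sequentially"
  then obtain l where l: "l \<in> cluster_points z" using cluster_points_nonempty by blast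
  define C where "C = connected_component_set (cluster_points z) l"
  have C: "C \<in> components (cluster_points z)" using l by (auto simp: C_def components_def)
  have "C \<subseteq> connected_component_set (critical_points f) l"
    unfolding C_def by (rule connected_component_mono[OF cluster_points_subset_critical_points])
  moreover have "compact (connected_component_set (critical_points f) l)"
    using l cluster_points_subset_critical_points by (intro comp) (auto simp: components_def)
  moreover have "closed C"
    unfolding C_def by (rule closed_connected_component[OF closed_cluster_points])
  ultimately have "compact C" by (metis compact_Int_closed inf.absorb_iff2)
  with C show "bounded (range z)"
    using bounded_if_component_compact steps_tendsto_zero l by blast
qed

lemma connected_cluster_points_if_bounded:
  assumes "bounded (range z)"
  shows "connected (cluster_points z)"
\<comment> \<open>The empty set is connected; any cluster point supplies the vanishing
  steps.\<close>
proof (cases "cluster_points z = {}")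
  case False
  then show ?thesis using connected_cluster_points[OF steps_tendsto_zero assms] by blast
qed simp

text \<open>Countability acts twice: it reduces each critical component to a point, hence a compact
  set, and then shrinks the connected set of cluster points to a single point.\<close>

lemma convergent_or_infinity:
  assumes count: "countable (critical_points f)"
  shows "filterlim (\<lambda>n. norm (z n)) at_top sequentially \<or> (\<exists>l \<in> critical_points f. z \<longlonglongrightarrow> l)"
proof (rule disj_imp[THEN iffD2], rule impI)
  assume ninf: "\<not> filterlim (\<lambda>n. norm (z n)) at_top sequentially"
  then obtain l where l: "l \<in> cluster_points z" using cluster_points_nonempty by blast
  have single: "\<exists>a. S \<subseteq> {a}" if "connected S" "S \<subseteq> critical_points f" for S
  proof -
    have "countable S" using count that(2) countable_subset by blast
    \<comment> \<open>Two distinct points would make the connected set \<open>S\<close>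
      uncountable.\<close>
    then have "x = y" if "x \<in> S" "y \<in> S" for x y
      using connected_uncountable[OF \<open>connected S\<close> that] by blast
    then show ?thesis by blast
  qed
  have "compact C" if C: "C \<in> components (critical_points f)" for C
  proof -
    obtain a where "C \<subseteq> {a}"
      using single in_components_connected[OF C] in_components_subset[OF C] by blast
    then show ?thesis using subset_singletonD by fastforce
  qed
  then have "connected (cluster_points z)"
    using bounded_or_infinity ninf connected_cluster_points_if_bounded by blast
  then obtain a where "cluster_points z \<subseteq> {a}"
    using single cluster_points_subset_critical_points by blast
  then have "cluster_points z = {l}" using l by blast
  then have "z \<longlonglongrightarrow> l" using tendsto_if_unique_cluster_point steps_tendsto_zero by blast
  then show "\<exists>l \<in> critical_points f. z \<longlonglongrightarrow> l" using l cluster_points_subset_critical_points by blast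
qed

end

theorem theorem2p1:
  fixes f :: "real ^ 'm \<Rightarrow> real"
    and \<delta>\<^sub>0 \<alpha> \<beta> :: real
    and z\<^sub>0 :: "real ^ 'm"
    and z :: "nat \<Rightarrow> real ^ 'm"
  assumes "C1_function f"
    and "\<delta>\<^sub>0 > 0"
    and "0 < \<alpha>" "\<alpha> < 1"
    and "0 < \<beta>" "\<beta> < 1"
    and "z 0 = z\<^sub>0"
    and "\<And>n. z (Suc n) = z n - backtracking_step \<alpha> \<beta> f \<delta>\<^sub>0 (z n) *\<^sub>R gradient f (z n)"
  shows "(filterlim (\<lambda>n. norm (z n)) at_top sequentially
            \<or> (\<lambda>n. norm (z (Suc n) - z n)) \<longlonglongrightarrow> 0)
       \<and> (countable (critical_points f) \<longrightarrow>
            filterlim (\<lambda>n. norm (z n)) at_top sequentially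
            \<or> (\<exists>l \<in> critical_points f. z \<longlonglongrightarrow> l))
       \<and> ((\<forall>C \<in> components (critical_points f). compact C) \<longrightarrow>
            (filterlim (\<lambda>n. norm (z n)) at_top sequentially \<or> bounded (range z))
            \<and> (bounded (range z) \<longrightarrow> connected (cluster_points z)))"
proof -
  interpret backtracking_descent f \<delta>\<^sub>0 \<alpha> \<beta> z
    using assms by unfold_locales
  show ?thesis
    using steps_tendsto_zero_or_infinity convergent_or_infinity bounded_or_infinity
      connected_cluster_points_if_bounded
    by (auto simp: dist_norm)
qed

end
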